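(* Let $B^-\subset SL_{n+1}(\mathbb C)$ be the subgroup of lower triangular matrices, with its geometric crystal structure of type $A_n$ described in the context, and for $x\in B^-$ let $u_j=u_j(x)$, $u_{j,k}=u_{j,k}(x)$ be the coordinates of the unipotent part $x_-$. Then an epsilon system on $B^-$ is given by $\varepsilon_{\{i\}}(x)=\varepsilon^*_{\{i\}}(x)=u_i$ and, for $1\le s<t\le n$, $$\varepsilon_{[s,t]}(x)=u_{s,t},\qquad \varepsilon^*_{[s,t]}(x)=\det(M_{s,t}),$$ where $M_{s,t}$ is the following minor of $x_-$: $$M_{s,t}=\begin{pmatrix}u_s&1&0&\cdots&0\\ u_{s,s+1}&u_{s+1}&1&\cdots&0\\ \vdots&\vdots&\ddots&\ddots&\vdots\\ u_{s,t-1}&u_{s+1,t-1}&\cdots&\cdots&1\\ u_{s,t}&u_{s+1,t}&\cdots&u_{t-1,t}&u_t\end{pmatrix},$$ i.e. the submatrix of $x_-$ with rows $s+1,\dots,t+1$ and columns $s,\dots,t$.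
   Context: Let $n\ge1$, $I=\{1,\dots,n\}$. Each $x\in B^-$ is written uniquely as $x=x_-x_0$ with $x_-$ lower unitriangular and $x_0=\mathrm{diag}(t_1,\dots,t_{n+1})$. The entries of $x_-$ are named: $(x_-)_{i,j}=u_j$ if $i=j+1$; $(x_-)_{i,j}=u_{j,i-1}$ if $i>j+1$; $(x_-)_{i,i}=1$; $0$ otherwise. The geometric crystal structure on $B^-$ is: $\gamma_i(x)=t_i/t_{i+1}$, $\varepsilon_i(x)=u_i$, and, for $c\in\mathbb C^\times$, $$e_i^c(x)=x_i\!\left(\frac{c-1}{\varepsilon_i(x)}\right)\cdot x\cdot x_i\!\left(\frac{c^{-1}-1}{\varphi_i(x)}\right),\qquad \varphi_i(x)=\gamma_i(x)\varepsilon_i(x),\quad x_i(z)=\mathrm{Id}_{n+1}+zE_{i,i+1},$$ with $E_{i,i+1}$ the matrix unit. Intervals: $[s,t]=\{s,s+1,\dots,t\}$; $\mathcal J$ is the set of nonempty intervals contained in $I$. A partition of an interval $J$ is a set $P=\{I_1,\dots,I_k\}$ of disjoint (nonempty) intervals with $I_1\sqcup\cdots\sqcup I_k=J$ and $\max(I_j)<\min(I_{j+1})$; $l(P)=k$; $\mathcal P_J$ is the set of partitions of $J$. Put $\varepsilon_P:=\varepsilon_{I_1}\cdots\varepsilon_{I_k}$. An epsilon system of a geometric crystal $(X,\{e_i\},\{\gamma_i\},\{\varepsilon_i\})$ of type $A_n$ is a set of rational functions $\{\varepsilon_J,\varepsilon^*_J\mid J\in\mathcal J\}$ on $X$ with $\varepsilon_{\{i\}}=\varepsilon_i$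 (the given function) such that, for every $J=[s,t]\in\mathcal J$ and $i\in I$ (as identities of rational functions): (a) $\varepsilon_J(e_i^cx)=c^{-1}\varepsilon_J(x)$ if $i=s$, and $\varepsilon_J(e_i^cx)=\varepsilon_J(x)$ if $i\ne s-1,s,t+1$; (b) $\varepsilon^*_J(e_i^cx)=c^{-1}\varepsilon^*_J(x)$ if $i=t$, and $\varepsilon^*_J(e_i^cx)=\varepsilon^*_J(x)$ if $i\neq s-1,t,t+1$; (c) $\varepsilon^*_J=\sum_{P\in\mathcal P_J}(-1)^{|J|-l(P)}\varepsilon_P$. *)

theory Defs
  imports
    Complex_Main
    "HOL-Library.Disjoint_Sets"
    "Jordan_Normal_Form.Determinant"
begin

section \<open>Rational functions\<close>

text \<open>
  An irreducible affine variety is presented by its set of points together with a set of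
  coordinate functions; its regular functions are the polynomials in the coordinates.
\<close>

record 'a affine_variety =
  points :: "'a set"
  coords :: "('a \<Rightarrow> complex) set"

inductive_set regular_functions :: "('a, 'b) affine_variety_scheme \<Rightarrow> ('a \<Rightarrow> complex) set"
  for V :: "('a, 'b) affine_variety_scheme" where
  const: "(\<lambda>x. a) \<in> regular_functions V"
| coord: "f \<in> coords V \<Longrightarrow> f \<in> regular_functions V"
| add: "f \<in> regular_functions V \<Longrightarrow> g \<in> regular_functions V \<Longrightarrow> (\<lambda>x. f x + g x) \<in> regular_functions V"
| mult: "f \<in> regular_functions V \<Longrightarrow> g \<in> regular_functions V \<Longrightarrow> (\<lambda>x. f x * g x) \<in> regular_functions V"

text \<open>
  A regular function that does not vanish identically on an irreducible variety is nonzero on a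
  dense open set. Rational functions are represented by total HOL functions whose values on a
  proper closed subset are irrelevant: \<open>rational_function\<close> says that \<open>f\<close> is given
  by a fraction of regular functions wherever the denominator is nonzero, and \<open>rational_eq\<close>
  is equality as rational functions.
\<close>

definition rational_function :: "('a, 'b) affine_variety_scheme \<Rightarrow> ('a \<Rightarrow> complex) \<Rightarrow> bool" where
  "rational_function V f \<longleftrightarrow>
     (\<exists>p \<in> regular_functions V. \<exists>q \<in> regular_functions V.
        (\<exists>x \<in> points V. q x \<noteq> 0) \<and> (\<forall>x \<in> points V. q x \<noteq> 0 \<longrightarrow> f x = p x / q x))"

definition rational_eq ::
  "('a, 'b) affine_variety_scheme \<Rightarrow> ('a \<Rightarrow> complex) \<Rightarrow> ('a \<Rightarrow> complex) \<Rightarrow> bool" where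
  "rational_eq V f g \<longleftrightarrow>
     (\<exists>q \<in> regular_functions V.
        (\<exists>x \<in> points V. q x \<noteq> 0) \<and> (\<forall>x \<in> points V. q x \<noteq> 0 \<longrightarrow> f x = g x))"


section \<open>Epsilon systems\<close>

text \<open>
  The data \<open>(X, {e\<^sub>i}, {\<gamma>\<^sub>i}, {\<epsilon>\<^sub>i})\<close> of a geometric crystal, with \<open>e\<^sub>i\<^sup>c x\<close> written
  \<open>crystal_e X i c x\<close>. The rational maps \<open>e\<^sub>i\<^sup>c\<close> are totalised like rational functions.
\<close>

record 'a crystal_data = "'a affine_variety" +
  crystal_e :: "nat \<Rightarrow> complex \<Rightarrow> 'a \<Rightarrow> 'a"
  crystal_gamma :: "nat \<Rightarrow> 'a \<Rightarrow> complex"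
  crystal_eps :: "nat \<Rightarrow> 'a \<Rightarrow> complex"

definition intervals :: "nat \<Rightarrow> nat set set" where
  "intervals n = {{s..t} | s t. 1 \<le> s \<and> s \<le> t \<and> t \<le> n}"

text \<open>The list enumerates the blocks as \<open>I\<^sub>1, \<dots>, I\<^sub>k\<close> with \<open>max I\<^sub>j < min I\<^sub>j\<^sub>+\<^sub>1\<close>.\<close>

definition interval_partitions :: "nat \<Rightarrow> nat set \<Rightarrow> nat set set set" where
  "interval_partitions n J =
     {P. P \<subseteq> intervals n \<and> partition_on J P \<and>
         (\<exists>Is. set Is = P \<and> distinct Is \<and> successively (\<lambda>A B. Max A < Min B) Is)}"

definition epsilon_system ::
  "nat \<Rightarrow> ('a, 'b) crystal_data_scheme \<Rightarrow>
   (nat set \<Rightarrow> 'a \<Rightarrow> complex) \<Rightarrow> (nat set \<Rightarrow> 'a \<Rightarrow> complex) \<Rightarrow> bool" where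
  "epsilon_system n X E Es \<longleftrightarrow>
     (\<forall>J \<in> intervals n. rational_function X (E J) \<and> rational_function X (Es J)) \<and>
     (\<forall>i \<in> {1..n}. rational_eq X (E {i}) (crystal_eps X i)) \<and>
     (\<forall>s t i c. 1 \<le> s \<and> s \<le> t \<and> t \<le> n \<and> i \<in> {1..n} \<and> c \<noteq> 0 \<longrightarrow>
        (i = s \<longrightarrow>
           rational_eq X (\<lambda>x. E {s..t} (crystal_e X i c x)) (\<lambda>x. inverse c * E {s..t} x)) \<and>
        (i + 1 \<noteq> s \<and> i \<noteq> s \<and> i \<noteq> t + 1 \<longrightarrow>
           rational_eq X (\<lambda>x. E {s..t} (crystal_e X i c x)) (\<lambda>x. E {s..t} x)) \<and>
        (i = t \<longrightarrow>
           rational_eq X (\<lambda>x. Es {s..t} (crystal_e X i c x)) (\<lambda>x. inverse c * Es {s..t} x)) \<and>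
        (i + 1 \<noteq> s \<and> i \<noteq> t \<and> i \<noteq> t + 1 \<longrightarrow>
           rational_eq X (\<lambda>x. Es {s..t} (crystal_e X i c x)) (\<lambda>x. Es {s..t} x))) \<and>
     (\<forall>J \<in> intervals n.
        rational_eq X (Es J)
          (\<lambda>x. \<Sum>P \<in> interval_partitions n J. (- 1) ^ (card J - card P) * (\<Prod>I \<in> P. E I x)))"


section \<open>The geometric crystal on lower triangular matrices\<close>

text \<open>Matrices in the library are indexed from 0; \<open>entry\<close> uses indices starting from 1.\<close>

definition entry :: "complex mat \<Rightarrow> nat \<Rightarrow> nat \<Rightarrow> complex" where
  "entry A i j = A $$ (i - 1, j - 1)"

definition Bminus :: "nat \<Rightarrow> complex mat set" where
  "Bminus n = {x \<in> carrier_mat (n + 1) (n + 1).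
     det x = 1 \<and> (\<forall>i \<in> {1..n+1}. \<forall>j \<in> {1..n+1}. i < j \<longrightarrow> entry x i j = 0)}"

definition lower_unitriangular :: "nat \<Rightarrow> complex mat \<Rightarrow> bool" where
  "lower_unitriangular n L \<longleftrightarrow> L \<in> carrier_mat (n + 1) (n + 1) \<and>
     (\<forall>i \<in> {1..n+1}. entry L i i = 1) \<and>
     (\<forall>i \<in> {1..n+1}. \<forall>j \<in> {1..n+1}. i < j \<longrightarrow> entry L i j = 0)"

definition unip_diag_decomp :: "nat \<Rightarrow> complex mat \<Rightarrow> complex mat \<Rightarrow> complex mat \<Rightarrow> bool" where
  "unip_diag_decomp n x L D \<longleftrightarrow>
     lower_unitriangular n L \<and> D \<in> carrier_mat (n + 1) (n + 1) \<and> diagonal_mat D \<and> x = L * D"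

definition unip_part :: "nat \<Rightarrow> complex mat \<Rightarrow> complex mat" where
  "unip_part n x = (THE L. \<exists>D. unip_diag_decomp n x L D)"

definition diag_part :: "nat \<Rightarrow> complex mat \<Rightarrow> complex mat" where
  "diag_part n x = (THE D. \<exists>L. unip_diag_decomp n x L D)"

text \<open>Existence and uniqueness of the decomposition, so that the descriptions above are proper.\<close>

lemma unip_diag_decomp_entry:
  assumes "unip_diag_decomp n x L D" "i < n + 1" "j < n + 1"
  shows "x $$ (i, j) = L $$ (i, j) * D $$ (j, j)"
proof -
  have L: "L \<in> carrier_mat (n+1) (n+1)" and D: "D \<in> carrier_mat (n+1) (n+1)"
    and dg: "diagonal_mat D" and x: "x = L * D"
    using assms(1) by (auto simp: unip_diag_decomp_def lower_unitriangular_def)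
  have "x $$ (i, j) = (\<Sum>k \<in> {0..<n+1}. L $$ (i, k) * D $$ (k, j))"
    using L D assms(2,3) by (auto simp: x scalar_prod_def)
  also have "\<dots> = (\<Sum>k \<in> {0..<n+1}. if k = j then L $$ (i, j) * D $$ (j, j) else 0)"
    using D dg assms(3) by (intro sum.cong) (auto simp: diagonal_mat_def)
  also have "\<dots> = L $$ (i, j) * D $$ (j, j)"
    using assms(3) by simp
  finally show ?thesis .
qed

lemma unip_diag_decomp_iff:
  assumes x: "x \<in> Bminus n"
  shows "unip_diag_decomp n x L D \<longleftrightarrow>
    L = mat (n + 1) (n + 1) (\<lambda>(i, j). x $$ (i, j) / x $$ (j, j)) \<and>
    D = mat (n + 1) (n + 1) (\<lambda>(i, j). if i = j then x $$ (j, j) else 0)"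
proof -
  let ?L = "mat (n + 1) (n + 1) (\<lambda>(i, j). x $$ (i, j) / x $$ (j, j))"
  let ?D = "mat (n + 1) (n + 1) (\<lambda>(i, j). if i = j then x $$ (j, j) else 0)"
  have xc: "x \<in> carrier_mat (n+1) (n+1)" and dx: "det x = 1"
    using x by (auto simp: Bminus_def)
  have low: "x $$ (i, j) = 0" if "i < j" "j < n + 1" for i j
  proof -
    have "entry x (i + 1) (j + 1) = 0" using x that by (auto simp: Bminus_def)
    then show ?thesis by (simp add: entry_def)
  qed
  have "(\<Prod>j \<in> {0..<n+1}. x $$ (j, j)) = 1"
    using det_lower_triangular[OF low xc] dx xc by (simp add: prod_list_diag_prod del: prod.op_ivl_Suc)
  then have nz: "x $$ (j, j) \<noteq> 0" if "j < n + 1" for j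
    using that prod_zero[of "{0..<n+1}" "\<lambda>j. x $$ (j, j)"] by fastforce
  show ?thesis
  proof
    assume d: "unip_diag_decomp n x L D"
    have Lc: "L \<in> carrier_mat (n+1) (n+1)" and Dc: "D \<in> carrier_mat (n+1) (n+1)"
      and dg: "diagonal_mat D"
      using d by (auto simp: unip_diag_decomp_def lower_unitriangular_def)
    have L1: "L $$ (j, j) = 1" if "j < n + 1" for j
    proof -
      have "entry L (j + 1) (j + 1) = 1"
        using d that by (auto simp: unip_diag_decomp_def lower_unitriangular_def)
      then show ?thesis by (simp add: entry_def)
    qed
    have Dj: "D $$ (j, j) = x $$ (j, j)" if "j < n + 1" for j
      using unip_diag_decomp_entry[OF d that that] L1[OF that] by simp
    have "L = ?L"
      using Lc Dj nz unip_diag_decomp_entry[OF d] by (intro eq_matI) auto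
    moreover have "D = ?D"
      using Dc Dj dg by (intro eq_matI) (auto simp: diagonal_mat_def)
    ultimately show "L = ?L \<and> D = ?D" ..
  next
    assume e: "L = ?L \<and> D = ?D"
    have lu: "lower_unitriangular n ?L"
      using nz low by (auto simp: lower_unitriangular_def entry_def)
    have dg: "diagonal_mat ?D" by (simp add: diagonal_mat_def)
    have "x = ?L * ?D"
    proof (rule eq_matI)
      fix i j assume "i < dim_row (?L * ?D)" "j < dim_col (?L * ?D)"
      then have ij: "i < n + 1" "j < n + 1" by auto
      have "(?L * ?D) $$ (i, j) = (\<Sum>k \<in> {0..<n+1}. ?L $$ (i, k) * ?D $$ (k, j))"
        using ij by (auto simp: scalar_prod_def simp del: sum.op_ivl_Suc)
      also have "\<dots> = (\<Sum>k \<in> {0..<n+1}. if k = j then x $$ (i, j) else 0)"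
        using ij nz by (intro sum.cong) auto
      also have "\<dots> = x $$ (i, j)" using ij by simp
      finally show "x $$ (i, j) = (?L * ?D) $$ (i, j)" by simp
    qed (use xc in auto)
    then show "unip_diag_decomp n x L D"
      using e lu dg by (auto simp: unip_diag_decomp_def)
  qed
qed

lemma unip_diag_decomp_unique:
  assumes "x \<in> Bminus n"
  shows "unip_diag_decomp n x L D \<longleftrightarrow> L = unip_part n x \<and> D = diag_part n x"
  unfolding unip_part_def diag_part_def unip_diag_decomp_iff[OF assms] by simp

definition coord_t :: "nat \<Rightarrow> complex mat \<Rightarrow> nat \<Rightarrow> complex" where
  "coord_t n x i = entry (diag_part n x) i i"

text \<open>The coordinates \<open>u\<^sub>j\<close> and, for \<open>j < k\<close>, \<open>u\<^sub>j\<^sub>,\<^sub>k\<close>.\<close>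

definition coord_u :: "nat \<Rightarrow> complex mat \<Rightarrow> nat \<Rightarrow> complex" where
  "coord_u n x j = entry (unip_part n x) (j + 1) j"

definition coord_uu :: "nat \<Rightarrow> complex mat \<Rightarrow> nat \<Rightarrow> nat \<Rightarrow> complex" where
  "coord_uu n x j k = entry (unip_part n x) (k + 1) j"

definition minor_M :: "nat \<Rightarrow> complex mat \<Rightarrow> nat \<Rightarrow> nat \<Rightarrow> complex mat" where
  "minor_M n x s t =
     mat (t + 1 - s) (t + 1 - s) (\<lambda>(a, b). entry (unip_part n x) (s + 1 + a) (s + b))"

definition elem_x :: "nat \<Rightarrow> nat \<Rightarrow> complex \<Rightarrow> complex mat" where
  "elem_x n i z =
     1\<^sub>m (n + 1) + z \<cdot>\<^sub>m mat (n + 1) (n + 1) (\<lambda>(a, b). if a + 1 = i \<and> b + 1 = i + 1 then 1 else 0)"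

definition gamma_B :: "nat \<Rightarrow> nat \<Rightarrow> complex mat \<Rightarrow> complex" where
  "gamma_B n i x = coord_t n x i / coord_t n x (i + 1)"

definition eps_B :: "nat \<Rightarrow> nat \<Rightarrow> complex mat \<Rightarrow> complex" where
  "eps_B n i x = coord_u n x i"

definition phi_B :: "nat \<Rightarrow> nat \<Rightarrow> complex mat \<Rightarrow> complex" where
  "phi_B n i x = gamma_B n i x * eps_B n i x"

definition e_B :: "nat \<Rightarrow> nat \<Rightarrow> complex \<Rightarrow> complex mat \<Rightarrow> complex mat" where
  "e_B n i c x =
     elem_x n i ((c - 1) / eps_B n i x) * x * elem_x n i ((inverse c - 1) / phi_B n i x)"

text \<open>
  The variety is closed in the affine space of all matrices (determinant equal to 1), so the matrix
  entries generate its coordinate ring.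
\<close>

definition Bminus_crystal :: "nat \<Rightarrow> complex mat crystal_data" where
  "Bminus_crystal n =
     \<lparr> points = Bminus n,
       coords = {\<lambda>x. entry x i j | i j. i \<in> {1..n+1} \<and> j \<in> {1..n+1}},
       crystal_e = e_B n,
       crystal_gamma = gamma_B n,
       crystal_eps = eps_B n \<rparr>"

end

theory Submission
  imports Defs
begin

text \<open>
  Write \<open>i = p + 1\<close>, so that with indices counted from 0 the matrix \<open>x\<^sub>i(z)\<close> adds \<open>z\<close> times row
  \<open>p + 1\<close> to row \<open>p\<close> when it multiplies from the left, and \<open>z\<close> times column \<open>p\<close> to column \<open>p + 1\<close>
  when it multiplies from the right. The crystal operator applies one operation of each kind to \<open>x\<close>.
  If \<open>u\<^sub>i \<noteq> 0\<close>, the two parameters are such that the row operation turns \<open>t\<^sub>i\<close> into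
  \<open>c t\<^sub>i\<close> and the column operation turns \<open>t\<^sub>i\<^sub>+\<^sub>1\<close> into \<open>c\<^sup>-\<^sup>1 t\<^sub>i\<^sub>+\<^sub>1\<close> and clears the entry
  above the diagonal. All other diagonal entries stay the same
  (\<open>e_B_diag\<close>, \<open>e_B_in_Bminus\<close>). Since \<open>u\<^sub>i\<close> is not identically zero on \<open>B\<^sup>-\<close>, an
  identity that holds where \<open>u\<^sub>i \<noteq> 0\<close> is an identity of rational functions.

  The coordinate \<open>u\<^sub>s\<^sub>,\<^sub>t\<close> is an entry of \<open>x\<close> divided by \<open>t\<^sub>s\<close>. If \<open>i\<close> is neither \<open>s - 1\<close> nor
  \<open>t + 1\<close>, this entry is in neither the changed row nor the changed column, so only the change of
  \<open>t\<^sub>s\<close> counts, which happens for \<open>i = s\<close> (\<open>coord_uu_e_B\<close>). Likewise \<open>det M\<^sub>s\<^sub>,\<^sub>t\<close> is a minor of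
  \<open>x\<close> divided by \<open>t\<^sub>s \<cdots> t\<^sub>t\<close>. For the same \<open>i\<close>, each of the two operations either
  leaves the submatrix alone or acts inside it, so the minor is invariant; and the product
  changes only for \<open>i = t\<close>, because for \<open>s \<le> i < t\<close> the factors \<open>c\<close> and \<open>c\<^sup>-\<^sup>1\<close> cancel
  (\<open>det_minor_M_e_B\<close>).

  The alternating sum over partitions holds at every point of \<open>B\<^sup>-\<close>. The matrix \<open>M\<^sub>s\<^sub>,\<^sub>t\<close> has ones
  just above the diagonal and zeros further right. For such a matrix, expansion along the
  last row expresses the determinant by those of the leading submatrices
  (\<open>det_hessenberg_rec\<close>). The signed sum over the partitions of \<open>{s..t}\<close>, sorted by
  the last block \<open>{k..t}\<close>, satisfies the same recursion (\<open>signed_partition_sum_rec\<close>), and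
  hence the two agree (\<open>signed_partition_sum_eq_hessenberg_det\<close>).
\<close>


section \<open>Partitions of an interval, sorted by their last block\<close>


text \<open>
  Half-open intervals make the recursion uniform: what is left of \<open>{s..<u}\<close> after its last block
  \<open>{k..<u}\<close> is \<open>{s..<k}\<close>, which is empty when there is only one block.
\<close>

lemma partition_remove_last_block:
  assumes "P \<subseteq> intervals n" "partition_on {s..<u} P" "s < u"
  obtains k where "k \<in> {s..<u}" "{k..<u} \<in> P" "partition_on {s..<k} (P - {{k..<u}})"
proof -
  have "u - 1 \<in> \<Union>P"
    using assms by (auto simp: partition_on_def)
  then obtain B where B: "B \<in> P" "u - 1 \<in> B" by auto
  obtain k l where kl: "B = {k..l}" "k \<le> l"
    using B assms(1) by (auto simp: intervals_def)
  have sub: "{k..l} \<subseteq> {s..<u}"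
    using B assms(2) kl by (auto simp: partition_on_def)
  then have ks: "s \<le> k" "l < u" using kl(2) by (simp_all add: subset_iff)
  then have l: "Suc l = u" "k < u" using B kl by auto
  have Beq: "B = {k..<u}" using kl l by auto
  have "partition_on ({s..<u} - {k..<u}) (P - {{k..<u}})"
    using assms(2) B Beq by (auto simp: partition_on_def disjoint_def)
  moreover have "{s..<u} - {k..<u} = {s..<k}" using ks l by auto
  ultimately show thesis using that[of k] ks l B Beq by auto
qed

lemma partition_add_last_block:
  assumes "1 \<le> s" "k \<in> {s..<u}" "u \<le> n + 1" "P \<subseteq> intervals n" "partition_on {s..<k} P"
  shows "insert {k..<u} P \<subseteq> intervals n" "partition_on {s..<u} (insert {k..<u} P)"
    "{k..<u} \<notin> P"
proof -
  have "{k..<u} = {k..u - 1}" "1 \<le> k" "k \<le> u - 1" "u - 1 \<le> n" using assms by auto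
  then have "{k..<u} \<in> intervals n" unfolding intervals_def by blast
  then show "insert {k..<u} P \<subseteq> intervals n" using assms by simp
  have U: "\<Union>P = {s..<k}" using assms by (simp add: partition_on_def)
  have "k \<in> {k..<u}" "k \<notin> \<Union>P" using U assms(2) by auto
  then show "{k..<u} \<notin> P" by blast
  have "disjnt {k..<u} B" if "B \<in> P" for B
  proof -
    have "B \<subseteq> {s..<k}" using that U by blast
    then show ?thesis by (auto simp: disjnt_iff)
  qed
  moreover have "{k..<u} \<union> {s..<k} = {s..<u}" using assms(2) by auto
  ultimately show "partition_on {s..<u} (insert {k..<u} P)"
    using assms(2,5) U by (auto simp: partition_on_def disjoint_def disjnt_def)
qed

text \<open>
  A set of intervals that partitions an interval can always be listed in increasing order: list the
  rest first, then append the last block.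
\<close>

lemma interval_partitions_atLeastLessThan:
  assumes "s \<le> u"
  shows "interval_partitions n {s..<u} = {P. P \<subseteq> intervals n \<and> partition_on {s..<u} P}"
proof -
  have "\<exists>Is. set Is = P \<and> distinct Is \<and> successively (\<lambda>A B. Max A < Min B) Is"
    if "P \<subseteq> intervals n" "partition_on {s..<u} P" for P
    using assms that
  proof (induction u arbitrary: P rule: less_induct)
    case (less u)
    show ?case
    proof (cases "s = u")
      case True
      then have "P = {}" using less.prems by (auto simp: partition_on_def)
      then show ?thesis by simp
    next
      case False
      then have "s < u" using less.prems(1) by simp
      then obtain k where k: "k \<in> {s..<u}" "{k..<u} \<in> P" "partition_on {s..<k} (P - {{k..<u}})"
        using partition_remove_last_block[OF less.prems(2,3)] by blast
      then obtain Is where Is: "set Is = P - {{k..<u}}" "distinct Is"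
          "successively (\<lambda>A B. Max A < Min B) Is"
        using less.IH[of k "P - {{k..<u}}"] less.prems(2) by auto
      have "Max (last Is) < Min {k..<u}" if "Is \<noteq> []"
      proof -
        have "last Is \<in> P - {{k..<u}}" using that Is(1) last_in_set by metis
        then have "last Is \<subseteq> {s..<k}" "last Is \<noteq> {}"
          using k(3) by (auto simp: partition_on_def)
        moreover from this have "Max (last Is) \<in> last Is"
          by (meson Max_in finite_atLeastLessThan finite_subset)
        moreover have "Min {k..<u} = k" using k by (intro Min_eqI) auto
        ultimately show ?thesis by auto
      qed
      then show ?thesis
        using Is k(2) by (intro exI[of _ "Is @ [{k..<u}]"]) (auto simp: successively_append_iff)
    qed
  qed
  then show ?thesis by (auto simp: interval_partitions_def)
qed

text \<open>
  Removing the last block is a bijection from the partitions of \<open>{s..<u}\<close> to the pairs of a start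
  \<open>k\<close> of that block and a partition of \<open>{s..<k}\<close>; it is injective because the last block is the
  only one that contains \<open>u - 1\<close>.
\<close>

lemma sum_interval_partitions_by_last_block:
  fixes f :: "nat set set \<Rightarrow> 'b::comm_monoid_add"
  assumes "1 \<le> s" "s < u" "u \<le> n + 1"
  shows "(\<Sum>P \<in> interval_partitions n {s..<u}. f P) =
    (\<Sum>k \<in> {s..<u}. \<Sum>P \<in> interval_partitions n {s..<k}. f (insert {k..<u} P))"
proof -
  let ?S = "Sigma {s..<u} (\<lambda>k. interval_partitions n {s..<k})"
  let ?g = "\<lambda>(k, P). insert {k..<u} P"
  have fin: "finite (interval_partitions n {s..<k})" for k
    by (rule finite_subset[of _ "Pow (Pow {s..<k})"])
       (auto simp: interval_partitions_def partition_on_def)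
  have unique: "k = k' \<and> P = P'"
    if "k \<in> {s..<u}" "P \<in> interval_partitions n {s..<k}"
      "k' \<in> {s..<u}" "P' \<in> interval_partitions n {s..<k'}"
      "insert {k..<u} P = insert {k'..<u} P'" for k k' P P'
  proof -
    have U: "\<Union>P = {s..<k}" "\<Union>P' = {s..<k'}"
      using that by (auto simp: interval_partitions_def partition_on_def)
    have last: "u - 1 \<in> {k..<u}" "u - 1 \<notin> \<Union>P" "u - 1 \<notin> \<Union>P'"
      using that(1,3) U by auto
    then have "{k..<u} = {k'..<u}" using that(5) by blast
    then have kk: "k = k'" using that(1,3) by (simp add: atLeastLessThan_eq_iff)
    moreover have "{k..<u} \<notin> P" "{k..<u} \<notin> P'"
      using last by blast+
    ultimately show ?thesis using that(5) insert_ident by metis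
  qed
  have "bij_betw ?g ?S (interval_partitions n {s..<u})"
  proof (rule bij_betwI')
    fix a b assume "a \<in> ?S" "b \<in> ?S"
    moreover obtain k P k' P' where "a = (k, P)" "b = (k', P')" by (metis surj_pair)
    ultimately show "(?g a = ?g b) = (a = b)"
      using unique[of k P k' P'] by (simp only: mem_Sigma_iff prod.case prod.inject) metis
  next
    fix a assume "a \<in> ?S"
    then obtain k P where a: "a = (k, P)" and k: "k \<in> {s..<u}"
      and P: "P \<subseteq> intervals n" "partition_on {s..<k} P"
      by (auto simp: interval_partitions_def)
    have "s \<le> u" using assms by simp
    then show "?g a \<in> interval_partitions n {s..<u}"
      using partition_add_last_block(1,2)[OF assms(1) k assms(3) P]
      by (simp add: a interval_partitions_atLeastLessThan)
  next
    fix P assume "P \<in> interval_partitions n {s..<u}"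
    then have P: "P \<subseteq> intervals n" "partition_on {s..<u} P"
      by (auto simp: interval_partitions_def)
    obtain k where k: "k \<in> {s..<u}" "{k..<u} \<in> P" "partition_on {s..<k} (P - {{k..<u}})"
      using partition_remove_last_block[OF P assms(2)] by blast
    then have "(k, P - {{k..<u}}) \<in> ?S"
      using P by (auto simp: interval_partitions_atLeastLessThan)
    moreover have "P = ?g (k, P - {{k..<u}})" using k by auto
    ultimately show "\<exists>a\<in>?S. P = ?g a" by blast
  qed
  from sum.reindex_bij_betw[OF this, of f, symmetric]
  show ?thesis using fin by (simp add: sum.Sigma split_beta)
qed

text \<open>
  The exponents \<open>card J - card P\<close> of the signs are therefore true differences.
\<close>

lemma card_interval_partition_le:
  assumes "P \<in> interval_partitions n {s..<u}"
  shows "finite P" "card P \<le> u - s"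
proof -
  have p: "partition_on {s..<u} P" using assms by (simp add: interval_partitions_def)
  then show fin: "finite P" by (metis finite_UnionD finite_atLeastLessThan partition_on_def)
  have B: "finite B \<and> 1 \<le> card B" if "B \<in> P" for B
  proof -
    have "B \<subseteq> {s..<u}" "B \<noteq> {}" using p that by (auto simp: partition_on_def)
    then show ?thesis by (metis One_nat_def Suc_leI card_gt_0_iff finite_atLeastLessThan finite_subset)
  qed
  have "card P = (\<Sum>B\<in>P. 1)" by simp
  also have "\<dots> \<le> (\<Sum>B\<in>P. card B)" using B by (intro sum_mono) auto
  also have "\<dots> = card {s..<u}" using product_partition[OF p] B by simp
  finally show "card P \<le> u - s" by simp
qed

section \<open>Hessenberg determinants as signed sums over partitions\<close>

definition signed_partition_sum :: "nat \<Rightarrow> (nat set \<Rightarrow> complex) \<Rightarrow> nat set \<Rightarrow> complex" where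
  "signed_partition_sum n e J =
     (\<Sum>P \<in> interval_partitions n J. (- 1) ^ (card J - card P) * (\<Prod>I \<in> P. e I))"

lemma signed_partition_sum_empty: "signed_partition_sum n e {} = 1"
proof -
  have "interval_partitions n {0..<0} = {{}}"
    unfolding interval_partitions_atLeastLessThan[OF order_refl] by (auto simp: partition_on_empty)
  then show ?thesis by (simp add: signed_partition_sum_def)
qed

text \<open>
  Adjoining a last block \<open>{k..<u}\<close> to a partition of \<open>{s..<k}\<close> raises the exponent by the size
  \<open>u - k\<close> of the block minus one.
\<close>

lemma signed_partition_sum_rec:
  assumes "1 \<le> s" "s < u" "u \<le> n + 1"
  shows "signed_partition_sum n e {s..<u} =
    (\<Sum>k \<in> {s..<u}. (- 1) ^ (u - 1 - k) * e {k..<u} * signed_partition_sum n e {s..<k})"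
  unfolding signed_partition_sum_def sum_interval_partitions_by_last_block[OF assms] sum_distrib_left
proof (intro sum.cong refl)
  fix k P assume k: "k \<in> {s..<u}" and P: "P \<in> interval_partitions n {s..<k}"
  note c = card_interval_partition_le[OF P]
  have new: "{k..<u} \<notin> P"
    using assms k P by (intro partition_add_last_block(3)[of s k u n]) (auto simp: interval_partitions_def)
  have "u - s - Suc (card P) = (u - 1 - k) + (k - s - card P)" using c k by auto
  then show "(- 1) ^ (card {s..<u} - card (insert {k..<u} P)) * prod e (insert {k..<u} P) =
      (- 1) ^ (u - 1 - k) * e {k..<u} * ((- 1) ^ (card {s..<k} - card P) * prod e P)"
    using c new by (simp add: power_add)
qed

text \<open>
  Deleting the last row and the column \<open>k\<close> leaves a block lower triangular matrix: the leading \<open>k \<times> k\<close>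
  submatrix, followed by a block with the former superdiagonal on its diagonal, which is lower
  unitriangular. Hence the cofactor in the Laplace expansion is a leading principal minor.
\<close>

lemma det_hessenberg_rec:
  fixes a :: "nat \<Rightarrow> nat \<Rightarrow> 'b::idom"
  assumes one: "\<And>i. i < m \<Longrightarrow> a i (Suc i) = 1"
    and zero: "\<And>i j. Suc i < j \<Longrightarrow> j \<le> m \<Longrightarrow> a i j = 0"
  shows "det (mat (Suc m) (Suc m) (\<lambda>(i, j). a i j)) =
    (\<Sum>k \<le> m. (- 1) ^ (m - k) * a m k * det (mat k k (\<lambda>(i, j). a i j)))"
proof -
  let ?A = "mat (Suc m) (Suc m) (\<lambda>(i, j). a i j)"
  have minor: "det (mat_delete ?A m k) = det (mat k k (\<lambda>(i, j). a i j))" if "k \<le> m" for k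
  proof -
    let ?T = "mat (m - k) (m - k) (\<lambda>(i, j). a (k + i) (Suc (k + j)))"
    have "mat_delete ?A m k = four_block_mat (mat k k (\<lambda>(i, j). a i j)) (0\<^sub>m k (m - k))
        (mat (m - k) k (\<lambda>(i, j). a (k + i) j)) ?T"
      using that by (intro eq_matI) (auto simp: mat_delete_def zero)
    then have "det (mat_delete ?A m k) = det (mat k k (\<lambda>(i, j). a i j)) * det ?T"
      by (simp add: det_four_block_mat_upper_right_zero[where n = k and m = "m - k"])
    moreover have "det ?T = 1"
      by (subst det_lower_triangular[of "m - k"]) (auto simp: zero one prod_list_diag_prod)
    ultimately show ?thesis by simp
  qed
  have "det ?A = (\<Sum>k<Suc m. ?A $$ (m, k) * cofactor ?A m k)"
    by (rule laplace_expansion_row) auto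
  also have "\<dots> = (\<Sum>k \<le> m. (- 1) ^ (m - k) * a m k * det (mat k k (\<lambda>(i, j). a i j)))"
  proof (rule sum.cong)
    fix k assume "k \<in> {..m}"
    then have km: "k \<le> m" by simp
    then have "(- 1 :: 'b) ^ (m + k) = (- 1) ^ (m - k)" by (simp add: neg_one_power_add_eq_neg_one_power_diff)
    then show "?A $$ (m, k) * cofactor ?A m k = (- 1) ^ (m - k) * a m k * det (mat k k (\<lambda>(i, j). a i j))"
      using km by (simp add: cofactor_def minor)
  qed auto
  finally show ?thesis .
qed

lemma signed_partition_sum_eq_hessenberg_det:
  assumes s: "1 \<le> s"
    and one: "\<And>i. s + i < n \<Longrightarrow> a i (Suc i) = 1"
    and zero: "\<And>i j. Suc i < j \<Longrightarrow> s + j \<le> n \<Longrightarrow> a i j = 0"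
    and low: "\<And>i j. j \<le> i \<Longrightarrow> s + i \<le> n \<Longrightarrow> a i j = e {s + j..s + i}"
    and m: "s + m \<le> n + 1"
  shows "signed_partition_sum n e {s..<s + m} = det (mat m m (\<lambda>(i, j). a i j))"
  using m
proof (induction m rule: less_induct)
  case (less m)
  show ?case
  proof (cases m)
    case 0
    then show ?thesis by (simp add: signed_partition_sum_empty det_dim_zero)
  next
    case (Suc l)
    have "signed_partition_sum n e {s..<s + m} =
      (\<Sum>k \<in> {s..<s + m}. (- 1) ^ (s + m - 1 - k) * e {k..<s + m} * signed_partition_sum n e {s..<k})"
      using s less.prems Suc by (intro signed_partition_sum_rec) auto
    also have "\<dots> = (\<Sum>k \<in> {0..<m}. (- 1) ^ (s + m - 1 - (k + s)) * e {k + s..<s + m} * signed_partition_sum n e {s..<k + s})"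
      using sum.shift_bounds_nat_ivl[of "\<lambda>k. (- 1) ^ (s + m - 1 - k) * e {k..<s + m} * signed_partition_sum n e {s..<k}" 0 s m]
      by (simp only: add_0_left add.commute[of m s])
    also have "\<dots> = (\<Sum>k \<le> l. (- 1) ^ (l - k) * a l k * det (mat k k (\<lambda>(i, j). a i j)))"
    proof (rule sum.cong)
      fix k assume "k \<in> {..l}"
      then have kl: "k \<le> l" by simp
      then have "signed_partition_sum n e {s..<k + s} = det (mat k k (\<lambda>(i, j). a i j))"
        using less.IH[of k] less.prems Suc by (simp add: add.commute)
      moreover have "e {k + s..<s + m} = a l k"
        using low[of k l] kl less.prems Suc by (simp add: atLeastLessThanSuc_atLeastAtMost add.commute)
      moreover have "s + m - 1 - (k + s) = l - k" using Suc by simp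
      ultimately show "(- 1) ^ (s + m - 1 - (k + s)) * e {k + s..<s + m} * signed_partition_sum n e {s..<k + s} =
         (- 1) ^ (l - k) * a l k * det (mat k k (\<lambda>(i, j). a i j))" by simp
    qed (use Suc in auto)
    also have "\<dots> = det (mat m m (\<lambda>(i, j). a i j))"
      using det_hessenberg_rec[of l a, OF one zero] Suc less.prems by simp
    finally show ?thesis .
  qed
qed

section \<open>Coordinates and minors of lower triangular matrices\<close>

lemma Bminus_carrier: "x \<in> Bminus n \<Longrightarrow> x \<in> carrier_mat (n + 1) (n + 1)"
  by (simp add: Bminus_def)

lemma Bminus_iff_index:
  "x \<in> Bminus n \<longleftrightarrow> x \<in> carrier_mat (n + 1) (n + 1) \<and> det x = 1 \<and>
     (\<forall>j k. j < k \<and> k \<le> n \<longrightarrow> x $$ (j, k) = 0)"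
proof -
  have "(\<forall>i \<in> {1..n+1}. \<forall>j \<in> {1..n+1}. i < j \<longrightarrow> entry x i j = 0) \<longleftrightarrow>
      (\<forall>j k. j < k \<and> k \<le> n \<longrightarrow> x $$ (j, k) = 0)" (is "?L = ?R")
  proof
    assume L: ?L
    show ?R
    proof (intro allI impI)
      fix j k assume "j < k \<and> k \<le> n"
      then show "x $$ (j, k) = 0" using L[rule_format, of "Suc j" "Suc k"] by (simp add: entry_def)
    qed
  next
    assume ?R
    show ?L
    proof (intro ballI impI)
      fix i j assume "i \<in> {1..n+1}" "j \<in> {1..n+1}" "i < j"
      then have "i - 1 < j - 1" "j - 1 \<le> n" by auto
      then show "entry x i j = 0" using \<open>?R\<close> unfolding entry_def by blast
    qed
  qed
  then show ?thesis by (simp add: Bminus_def)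
qed

lemma Bminus_diag_nonzero:
  assumes x: "x \<in> Bminus n" and "j \<le> n"
  shows "x $$ (j, j) \<noteq> 0"
proof -
  have "det x = prod_list (diag_mat x)"
    using x by (intro det_lower_triangular[of "n + 1"]) (auto simp: Bminus_iff_index)
  then have "(\<Prod>j \<in> {0..<n + 1}. x $$ (j, j)) = 1"
    using x Bminus_carrier[OF x] by (simp add: prod_list_diag_prod Bminus_def del: prod.op_ivl_Suc)
  then show ?thesis
    using assms(2) prod_zero[of "{0..<n + 1}" "\<lambda>j. x $$ (j, j)"] by fastforce
qed

lemma unip_part_index:
  assumes "x \<in> Bminus n" "j \<le> n" "k \<le> n"
  shows "unip_part n x $$ (j, k) = x $$ (j, k) / x $$ (k, k)"
  using unip_diag_decomp_unique[OF assms(1), of "unip_part n x" "diag_part n x"] assms(2,3)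
  by (simp add: unip_diag_decomp_iff[OF assms(1)])

lemma coord_t_index:
  assumes "x \<in> Bminus n" "j \<le> n"
  shows "coord_t n x (Suc j) = x $$ (j, j)"
  using unip_diag_decomp_unique[OF assms(1), of "unip_part n x" "diag_part n x"] assms(2)
  by (simp add: unip_diag_decomp_iff[OF assms(1)] coord_t_def entry_def)

lemma coord_uu_index:
  assumes "x \<in> Bminus n" "s \<le> t" "t < n + 1" "1 \<le> s"
  shows "coord_uu n x s t = x $$ (t, s - 1) / x $$ (s - 1, s - 1)"
  using assms unip_part_index[of x n t "s - 1"] by (simp add: coord_uu_def entry_def)

lemma coord_u_eq_coord_uu: "coord_u n x s = coord_uu n x s s"
  by (simp add: coord_u_def coord_uu_def)

lemma det_minor_M_singleton: "det (minor_M n x s s) = coord_u n x s"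
  by (subst det_single) (auto simp: minor_M_def coord_u_def)

text \<open>
  The analogue of \<open>M\<^sub>s\<^sub>,\<^sub>t\<close> for \<open>x\<close> itself, with \<open>r = s - 1\<close> and \<open>m = t - s + 1\<close>: its entries are
  those of \<open>x\<close> and not fractions, and row and column operations on \<open>x\<close> act on it directly.
\<close>

definition subdiagonal_window :: "'b mat \<Rightarrow> nat \<Rightarrow> nat \<Rightarrow> 'b mat" where
  "subdiagonal_window x r m = mat m m (\<lambda>(a, b). x $$ (Suc r + a, r + b))"

text \<open>
  Passing from \<open>x\<close> to its unitriangular part divides each column by its diagonal entry.
\<close>

lemma det_minor_M:
  assumes x: "x \<in> Bminus n" and r: "r + m \<le> n"
  shows "det (minor_M n x (Suc r) (r + m)) =
    det (subdiagonal_window x r m) / (\<Prod>j = r..<r + m. x $$ (j, j))"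
proof -
  let ?d = "\<lambda>b. inverse (x $$ (r + b, r + b))"
  have "minor_M n x (Suc r) (r + m) = subdiagonal_window x r m * mat_diag m ?d"
    using r by (subst mat_diag_mult_right[of _ m])
      (auto simp: minor_M_def subdiagonal_window_def entry_def unip_part_index[OF x] divide_inverse)
  then have "det (minor_M n x (Suc r) (r + m)) = det (subdiagonal_window x r m) * det (mat_diag m ?d)"
    by (simp add: det_mult[of _ m] subdiagonal_window_def)
  also have "det (mat_diag m ?d) = (\<Prod>b = 0..<m. ?d b)"
    by (subst det_lower_triangular[of m]) (auto simp: mat_diag_def prod_list_diag_prod)
  also have "\<dots> = inverse (\<Prod>j = r..<r + m. x $$ (j, j))"
    using prod.shift_bounds_nat_ivl[of "\<lambda>j. x $$ (j, j)" 0 r m]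
    by (simp add: prod_inversef[symmetric] o_def add.commute)
  finally show ?thesis by (simp add: divide_inverse)
qed

section \<open>The crystal operators as row and column operations\<close>

lemma elem_x_eq_addrow_mat: "elem_x n (Suc p) z = addrow_mat (n + 1) z p (Suc p)"
  by (rule eq_matI) (auto simp: elem_x_def)

lemma e_B_row_col:
  assumes x: "x \<in> Bminus n" and p: "p < n"
  shows "e_B n (Suc p) c x =
    addcol ((inverse c - 1) / phi_B n (Suc p) x) (Suc p) p
      (addrow ((c - 1) / eps_B n (Suc p) x) p (Suc p) x)"
proof -
  note xc = Bminus_carrier[OF x]
  let ?y = "addrow ((c - 1) / eps_B n (Suc p) x) p (Suc p) x"
  have yc: "?y \<in> carrier_mat (n + 1) (n + 1)" using xc by (simp only: addrow_carrier)
  have pn: "p < n + 1" "Suc p < n + 1" using p by auto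
  show ?thesis
    unfolding e_B_def elem_x_eq_addrow_mat
    by (simp only: addrow_mat[OF xc pn(2), symmetric] addcol_mat[OF yc pn(1)])
qed

lemma e_B_index_unchanged:
  assumes "x \<in> Bminus n" "p < n" "j \<le> n" "k \<le> n" "j \<noteq> p" "k \<noteq> Suc p"
  shows "e_B n (Suc p) c x $$ (j, k) = x $$ (j, k)"
  using assms Bminus_carrier[OF assms(1)] by (simp add: e_B_row_col)

lemma eps_phi_index:
  assumes "x \<in> Bminus n" "p < n"
  shows "eps_B n (Suc p) x = x $$ (Suc p, p) / x $$ (p, p)"
    "phi_B n (Suc p) x = x $$ (Suc p, p) / x $$ (Suc p, Suc p)"
  using assms Bminus_diag_nonzero[OF assms(1), of p]
  by (simp_all add: phi_B_def gamma_B_def eps_B_def coord_u_eq_coord_uu coord_uu_index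
      coord_t_index)

text \<open>
  With \<open>a = (c - 1) / \<epsilon>\<^sub>i(x)\<close> and \<open>b = (c\<^sup>-\<^sup>1 - 1) / \<phi>\<^sub>i(x)\<close>, the only place above the diagonal that
  could become nonzero is \<open>(p, p + 1)\<close>. There the row operation produces
  \<open>a x\<^sub>p\<^sub>+\<^sub>1\<^sub>,\<^sub>p\<^sub>+\<^sub>1\<close> and the column operation adds \<open>b c x\<^sub>p\<^sub>,\<^sub>p\<close>, which cancels it.
\<close>

lemma
  assumes x: "x \<in> Bminus n" and p: "p < n" and c: "c \<noteq> 0" and nz: "x $$ (Suc p, p) \<noteq> 0"
  shows e_B_diag: "j \<le> n \<Longrightarrow> e_B n (Suc p) c x $$ (j, j) =
      x $$ (j, j) * ((if j = p then c else 1) * (if j = Suc p then inverse c else 1))"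
    and e_B_in_Bminus: "e_B n (Suc p) c x \<in> Bminus n"
proof -
  note xc = Bminus_carrier[OF x]
  have up: "x $$ (j, k) = 0" if "j < k" "k \<le> n" for j k
    using x that by (simp add: Bminus_iff_index)
  have dp: "x $$ (p, p) \<noteq> 0" "x $$ (Suc p, Suc p) \<noteq> 0"
    using Bminus_diag_nonzero[OF x] p by auto
  show "e_B n (Suc p) c x $$ (j, j) =
      x $$ (j, j) * ((if j = p then c else 1) * (if j = Suc p then inverse c else 1))" if "j \<le> n"
    using that p xc up[of p "Suc p"] dp nz
    by (auto simp: e_B_row_col[OF x p] eps_phi_index[OF x p] field_simps)
  have "det (e_B n (Suc p) c x) = 1"
    using p xc x by (simp add: e_B_row_col[OF x p] det_addcol[of _ "n + 1"] det_addrow[of _ "n + 1"] Bminus_def)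
  moreover have "e_B n (Suc p) c x $$ (j, k) = 0" if "j < k" "k \<le> n" for j k
  proof (cases "j = p \<and> k = Suc p")
    case True
    then show ?thesis
      using p xc up[of p "Suc p"] dp nz c
      by (simp add: e_B_row_col[OF x p] eps_phi_index[OF x p] field_simps)
  next
    case False
    then show ?thesis
      using that p xc up[of j k] up[of j p] up[of "Suc p" k] up[of "Suc p" p]
      by (auto simp: e_B_row_col[OF x p])
  qed
  moreover have "e_B n (Suc p) c x \<in> carrier_mat (n + 1) (n + 1)"
    using carrier_matD[OF xc] by (intro carrier_matI) (simp_all add: e_B_row_col[OF x p])
  ultimately show "e_B n (Suc p) c x \<in> Bminus n" by (simp add: Bminus_iff_index)
qed

text \<open>
  The window has rows \<open>r + 1, \<dots>, r + m\<close>. The determinant could change only if row \<open>p\<close> were in the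
  window and row \<open>p + 1\<close> were not, that is, for \<open>p = r + m\<close>.
\<close>

lemma det_subdiagonal_window_addrow:
  assumes x: "x \<in> carrier_mat (n + 1) (n + 1)" and "r + m \<le> n" "p < n" "p \<noteq> r + m"
  shows "det (subdiagonal_window (addrow a p (Suc p) x) r m) = det (subdiagonal_window x r m)"
proof (cases "r < p \<and> p < r + m")
  case True
  then have "subdiagonal_window (addrow a p (Suc p) x) r m =
      addrow a (p - Suc r) (p - r) (subdiagonal_window x r m)"
    using assms by (intro eq_matI) (auto simp: subdiagonal_window_def)
  moreover have "p - r < m" "p - Suc r \<noteq> p - r" using True by auto
  ultimately show ?thesis
    by (simp add: det_addrow[of _ m] subdiagonal_window_def)
next
  case False
  then have "p \<noteq> Suc (r + a)" if "a < m" for a using that assms(4) by linarith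
  then have "subdiagonal_window (addrow a p (Suc p) x) r m = subdiagonal_window x r m"
    using assms(1,2) by (intro eq_matI) (simp_all add: subdiagonal_window_def)
  then show ?thesis by simp
qed

text \<open>
  The window has columns \<open>r, \<dots>, r + m - 1\<close>. The determinant could change only if column \<open>p + 1\<close>
  were in the window and column \<open>p\<close> were not, that is, for \<open>p + 1 = r\<close>.
\<close>

lemma det_subdiagonal_window_addcol:
  assumes x: "x \<in> carrier_mat (n + 1) (n + 1)" and "r + m \<le> n" "p < n" "Suc p \<noteq> r"
  shows "det (subdiagonal_window (addcol b (Suc p) p x) r m) = det (subdiagonal_window x r m)"
proof (cases "r \<le> p \<and> Suc p < r + m")
  case True
  then have "subdiagonal_window (addcol b (Suc p) p x) r m =
      addcol b (Suc p - r) (p - r) (subdiagonal_window x r m)"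
    using assms by (intro eq_matI) (auto simp: subdiagonal_window_def)
  moreover have "p - r < m" "Suc p - r \<noteq> p - r" using True by auto
  ultimately show ?thesis
    by (simp add: det_addcol[of _ m] subdiagonal_window_def)
next
  case False
  then have "Suc p \<noteq> r + b" if "b < m" for b using that assms(4) by linarith
  then have "subdiagonal_window (addcol b (Suc p) p x) r m = subdiagonal_window x r m"
    using assms(1,2) by (intro eq_matI) (simp_all add: subdiagonal_window_def)
  then show ?thesis by simp
qed

lemma det_subdiagonal_window_e_B:
  assumes x: "x \<in> Bminus n" and p: "p < n" "r + m \<le> n" "Suc p \<noteq> r" "p \<noteq> r + m"
  shows "det (subdiagonal_window (e_B n (Suc p) c x) r m) = det (subdiagonal_window x r m)"
  unfolding e_B_row_col[OF x p(1)] using p Bminus_carrier[OF x]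
  by (subst det_subdiagonal_window_addcol[where n = n])
    (auto simp: det_subdiagonal_window_addrow[where n = n])

lemma coord_uu_e_B:
  assumes x: "x \<in> Bminus n" and p: "p < n" and c: "c \<noteq> 0" and nz: "x $$ (Suc p, p) \<noteq> 0"
    and st: "1 \<le> s" "s \<le> t" "t \<le> n" and i: "Suc (Suc p) \<noteq> s" "p \<noteq> t"
  shows "coord_uu n (e_B n (Suc p) c x) s t =
    (if Suc p = s then inverse c else 1) * coord_uu n x s t"
proof -
  have "e_B n (Suc p) c x $$ (t, s - 1) = x $$ (t, s - 1)"
    using x p st i by (intro e_B_index_unchanged) auto
  moreover have "e_B n (Suc p) c x $$ (s - 1, s - 1) =
      x $$ (s - 1, s - 1) * (if Suc p = s then c else 1)"
    using st i by (subst e_B_diag[OF x p c nz]) auto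
  ultimately show ?thesis
    using st c by (simp add: coord_uu_index[OF x] coord_uu_index[OF e_B_in_Bminus[OF x p c nz]] field_simps)
qed

text \<open>
  The minor of \<open>x\<close> is invariant, so the determinant scales by the inverse of the factor that the
  product \<open>t\<^sub>s \<cdots> t\<^sub>t\<close> of the diagonal entries acquires.
\<close>

lemma det_minor_M_e_B:
  assumes x: "x \<in> Bminus n" and p: "p < n" and c: "c \<noteq> 0" and nz: "x $$ (Suc p, p) \<noteq> 0"
    and st: "1 \<le> s" "s \<le> t" "t \<le> n" and i: "Suc (Suc p) \<noteq> s" "p \<noteq> t"
  shows "det (minor_M n (e_B n (Suc p) c x) s t) =
    (if Suc p = t then inverse c else 1) * det (minor_M n x s t)"
proof -
  define r m where "r = s - 1" and "m = Suc t - s"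
  have rm: "s = Suc r" "t = r + m" "0 < m" "r + m \<le> n" using st by (auto simp: r_def m_def)
  let ?y = "e_B n (Suc p) c x"
  have "(\<Prod>j = r..<r + m. ?y $$ (j, j)) = (\<Prod>j = r..<r + m. x $$ (j, j) *
      ((if j = p then c else 1) * (if j = Suc p then inverse c else 1)))"
    using rm by (intro prod.cong) (auto simp: e_B_diag[OF x p c nz])
  also have "\<dots> = (\<Prod>j = r..<r + m. x $$ (j, j)) *
      ((if p \<in> {r..<r + m} then c else 1) * (if Suc p \<in> {r..<r + m} then inverse c else 1))"
    by (simp only: prod.distrib prod.delta finite_atLeastLessThan)
  \<comment> \<open>Since \<open>p + 1 \<noteq> r\<close>, the factors can fail to cancel only if \<open>p\<close> is the last column of the
    window, which means \<open>p + 1 = t\<close>.\<close>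
  also have "(if p \<in> {r..<r + m} then c else 1) * (if Suc p \<in> {r..<r + m} then inverse c else 1) =
      (if Suc p = t then c else 1)"
    using rm i c by auto
  finally have P: "(\<Prod>j = r..<r + m. ?y $$ (j, j)) =
      (\<Prod>j = r..<r + m. x $$ (j, j)) * (if Suc p = t then c else 1)" .
  have "det (subdiagonal_window ?y r m) = det (subdiagonal_window x r m)"
    using x p rm i by (intro det_subdiagonal_window_e_B) auto
  then show ?thesis
    unfolding rm(1,2) det_minor_M[OF x rm(4)] det_minor_M[OF e_B_in_Bminus[OF x p c nz] rm(4)]
    using P rm(2) by (simp add: field_simps)
qed

section \<open>Rational functions on the group of lower triangular matrices\<close>

lemma regular_functions_sum:
  "finite A \<Longrightarrow> (\<And>a. a \<in> A \<Longrightarrow> f a \<in> regular_functions V) \<Longrightarrow>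
    (\<lambda>x. \<Sum>a\<in>A. f a x) \<in> regular_functions V"
  by (induction A rule: finite_induct) (auto intro: regular_functions.intros)

lemma regular_functions_prod:
  "finite A \<Longrightarrow> (\<And>a. a \<in> A \<Longrightarrow> f a \<in> regular_functions V) \<Longrightarrow>
    (\<lambda>x. \<Prod>a\<in>A. f a x) \<in> regular_functions V"
  by (induction A rule: finite_induct) (auto intro: regular_functions.intros)

lemma regular_functions_det:
  assumes "\<And>i j. i < m \<Longrightarrow> j < m \<Longrightarrow> f i j \<in> regular_functions V"
  shows "(\<lambda>x. det (mat m m (\<lambda>(i, j). f i j x))) \<in> regular_functions V"
proof -
  have "(\<lambda>x. \<Sum>p \<in> {p. p permutes {0..<m}}. signof p * (\<Prod>i = 0..<m. f i (p i) x)) \<in> regular_functions V"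
    using assms by (intro regular_functions_sum regular_functions.mult regular_functions.const
        regular_functions_prod finite_permutations) (auto dest: permutes_in_image)
  moreover have "det (mat m m (\<lambda>(i, j). f i j x)) =
      (\<Sum>p \<in> {p. p permutes {0..<m}}. signof p * (\<Prod>i = 0..<m. f i (p i) x))" for x
    by (subst det_def'[of _ m]) (auto intro!: sum.cong prod.cong dest: permutes_in_image)
  ultimately show ?thesis by simp
qed

lemma regular_functions_index:
  assumes "j \<le> n" "k \<le> n"
  shows "(\<lambda>x. x $$ (j, k)) \<in> regular_functions (Bminus_crystal n)"
proof (rule regular_functions.coord)
  have "(\<lambda>x. x $$ (j, k)) = (\<lambda>x. entry x (Suc j) (Suc k))" by (simp add: entry_def)
  then show "(\<lambda>x. x $$ (j, k)) \<in> coords (Bminus_crystal n)"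
    using assms unfolding Bminus_crystal_def by fastforce
qed

lemma points_Bminus_crystal [simp]: "points (Bminus_crystal n) = Bminus n"
  by (simp add: Bminus_crystal_def)

lemma one_mat_in_Bminus: "1\<^sub>m (n + 1) \<in> Bminus n"
  by (simp add: Bminus_iff_index)

lemma rational_function_BminusI:
  assumes "p \<in> regular_functions (Bminus_crystal n)" "q \<in> regular_functions (Bminus_crystal n)"
    and "\<And>x. x \<in> Bminus n \<Longrightarrow> q x \<noteq> 0" "\<And>x. x \<in> Bminus n \<Longrightarrow> f x = p x / q x"
  shows "rational_function (Bminus_crystal n) f"
  unfolding rational_function_def points_Bminus_crystal using assms one_mat_in_Bminus by blast

lemma rational_eq_BminusI:
  assumes "\<And>x. x \<in> Bminus n \<Longrightarrow> f x = g x"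
  shows "rational_eq (Bminus_crystal n) f g"
  unfolding rational_eq_def points_Bminus_crystal
  using assms one_mat_in_Bminus by (intro bexI[of _ "\<lambda>x. 1"] regular_functions.const) auto

text \<open>
  The set where \<open>u\<^sub>p\<^sub>+\<^sub>1 \<noteq> 0\<close> is where the crystal operator with index \<open>p + 1\<close> is given by its formula.
  It is not empty: it contains the elementary matrix with an entry 1 in row \<open>p + 1\<close> and column \<open>p\<close>.
\<close>

lemma rational_eq_Bminus_genericI:
  assumes "p < n" "\<And>x. x \<in> Bminus n \<Longrightarrow> x $$ (Suc p, p) \<noteq> 0 \<Longrightarrow> f x = g x"
  shows "rational_eq (Bminus_crystal n) f g"
proof -
  let ?w = "addrow_mat (n + 1) 1 (Suc p) p :: complex mat"
  have "?w \<in> Bminus n" using assms(1) by (auto simp: Bminus_iff_index det_addrow_mat)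
  moreover have "?w $$ (Suc p, p) \<noteq> 0" using assms(1) by simp
  ultimately have "\<exists>x \<in> Bminus n. x $$ (Suc p, p) \<noteq> 0" by blast
  then show ?thesis
    unfolding rational_eq_def points_Bminus_crystal
    using assms by (intro bexI[of _ "\<lambda>x. x $$ (Suc p, p)"] regular_functions_index) auto
qed

section \<open>The epsilon system\<close>

text \<open>
  The matrix \<open>M\<^sub>s\<^sub>,\<^sub>t\<close> is a Hessenberg matrix: its superdiagonal is a piece of the diagonal of the
  unitriangular part, and everything further to the right lies above that diagonal. Its entries on
  and below the diagonal are the coordinates belonging to subintervals of \<open>{s..t}\<close>.
\<close>

lemma signed_partition_sum_coord_uu:
  assumes x: "x \<in> Bminus n" and st: "1 \<le> s" "s \<le> t" "t \<le> n"
    and e: "\<And>j k. 1 \<le> j \<Longrightarrow> j \<le> k \<Longrightarrow> k \<le> n \<Longrightarrow> e {j..k} = coord_uu n x j k"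
  shows "signed_partition_sum n e {s..t} = det (minor_M n x s t)"
proof -
  let ?a = "\<lambda>i j. entry (unip_part n x) (s + 1 + i) (s + j)"
  have "signed_partition_sum n e {s..<s + (t + 1 - s)} =
      det (mat (t + 1 - s) (t + 1 - s) (\<lambda>(i, j). ?a i j))"
  proof (rule signed_partition_sum_eq_hessenberg_det)
    fix i assume "s + i < n"
    then show "?a i (Suc i) = 1"
      using Bminus_diag_nonzero[OF x, of "s + i"] by (simp add: entry_def unip_part_index[OF x])
  next
    fix i j assume ij: "Suc i < j" "s + j \<le> n"
    then have "s + i < s + j - 1" "s + j - 1 \<le> n" by auto
    then have "x $$ (s + i, s + j - 1) = 0" using x unfolding Bminus_iff_index by blast
    then show "?a i j = 0" using ij by (simp add: entry_def unip_part_index[OF x])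
  next
    fix i j assume "j \<le> i" "s + i \<le> n"
    then show "?a i j = e {s + j..s + i}"
      using st(1) by (simp add: e coord_uu_def)
  qed (use st in auto)
  moreover have "{s..<s + (t + 1 - s)} = {s..t}" using st by auto
  ultimately show ?thesis by (simp add: minor_M_def)
qed

lemma rational_function_coord_uu:
  assumes "1 \<le> s" "s \<le> t" "t \<le> n"
  shows "rational_function (Bminus_crystal n) (\<lambda>x. coord_uu n x s t)"
proof (rule rational_function_BminusI)
  show "(\<lambda>x. x $$ (t, s - 1)) \<in> regular_functions (Bminus_crystal n)"
    "(\<lambda>x. x $$ (s - 1, s - 1)) \<in> regular_functions (Bminus_crystal n)"
    using assms by (auto intro!: regular_functions_index)
qed (use assms in \<open>auto simp: Bminus_diag_nonzero coord_uu_index\<close>)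

lemma rational_function_det_minor_M:
  assumes "1 \<le> s" "s \<le> t" "t \<le> n"
  shows "rational_function (Bminus_crystal n) (\<lambda>x. det (minor_M n x s t))"
proof -
  define r m where "r = s - 1" and "m = Suc t - s"
  have rm: "s = Suc r" "t = r + m" "r + m \<le> n" using assms by (auto simp: r_def m_def)
  show ?thesis
    unfolding rm(1,2)
  proof (rule rational_function_BminusI)
    show "(\<lambda>x. det (subdiagonal_window x r m)) \<in> regular_functions (Bminus_crystal n)"
      unfolding subdiagonal_window_def using rm(3)
      by (intro regular_functions_det regular_functions_index) auto
    show "(\<lambda>x. \<Prod>j = r..<r + m. x $$ (j, j)) \<in> regular_functions (Bminus_crystal n)"
      using rm(3) by (intro regular_functions_prod regular_functions_index) auto
  qed (use rm(3) in \<open>auto simp: Bminus_diag_nonzero det_minor_M\<close>)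
qed

theorem proposition6p1:
  fixes n :: nat
    and E Es :: "nat set \<Rightarrow> complex mat \<Rightarrow> complex"
  assumes "n \<ge> 1"
    and "\<forall>i \<in> {1..n}. \<forall>x \<in> Bminus n. E {i} x = coord_u n x i \<and> Es {i} x = coord_u n x i"
    and "\<forall>s t. 1 \<le> s \<and> s < t \<and> t \<le> n \<longrightarrow>
           (\<forall>x \<in> Bminus n. E {s..t} x = coord_uu n x s t \<and> Es {s..t} x = det (minor_M n x s t))"
  shows "epsilon_system n (Bminus_crystal n) E Es"
proof -
  let ?X = "Bminus_crystal n"
  have E: "E {s..t} x = coord_uu n x s t" and Es: "Es {s..t} x = det (minor_M n x s t)"
    if "1 \<le> s" "s \<le> t" "t \<le> n" "x \<in> Bminus n" for s t x
    using assms(2)[rule_format, of s x] assms(3)[rule_format, of s t x] that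
    by (cases "s = t"; simp add: coord_u_eq_coord_uu det_minor_M_singleton)+
  have regular: "rational_function ?X (E J) \<and> rational_function ?X (Es J)" if Jn: "J \<in> intervals n" for J
  proof -
    obtain s t where J: "J = {s..t}" and st: "1 \<le> s" "s \<le> t" "t \<le> n"
      using Jn by (auto simp: intervals_def)
    have "rational_function ?X (E {s..t}) \<longleftrightarrow> rational_function ?X (\<lambda>x. coord_uu n x s t)"
      "rational_function ?X (Es {s..t}) \<longleftrightarrow> rational_function ?X (\<lambda>x. det (minor_M n x s t))"
      unfolding rational_function_def points_Bminus_crystal
      by (simp_all add: E[OF st] Es[OF st] cong: ball_cong)
    then show ?thesis
      using rational_function_coord_uu[OF st] rational_function_det_minor_M[OF st] by (simp add: J)
  qed
  have eps: "rational_eq ?X (E {i}) (crystal_eps ?X i)" if "i \<in> {1..n}" for i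
    using assms(2) that
    by (intro rational_eq_BminusI) (simp add: Bminus_crystal_def eps_B_def)
  \<comment> \<open>Writing the factor as a conditional treats the scaling and the invariant case of an axiom at
    once; the indices that remain are exactly those for which the axioms make a claim.\<close>
  have invariance:
    "rational_eq ?X (\<lambda>x. E {s..t} (crystal_e ?X i c x)) (\<lambda>x. (if i = s then inverse c else 1) * E {s..t} x)"
    "rational_eq ?X (\<lambda>x. Es {s..t} (crystal_e ?X i c x)) (\<lambda>x. (if i = t then inverse c else 1) * Es {s..t} x)"
    if st: "1 \<le> s" "s \<le> t" "t \<le> n" and i: "i \<in> {1..n}" "i + 1 \<noteq> s" "i \<noteq> t + 1" and c: "c \<noteq> 0"
    for s t i c
  proof -
    obtain p where p: "i = Suc p" using i(1) by (cases i) auto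
    have pn: "p < n" and ne: "Suc (Suc p) \<noteq> s" "p \<noteq> t" using i p by auto
    have e: "crystal_e ?X i c = e_B n (Suc p) c" by (simp add: Bminus_crystal_def p)
    show "rational_eq ?X (\<lambda>x. E {s..t} (crystal_e ?X i c x))
        (\<lambda>x. (if i = s then inverse c else 1) * E {s..t} x)"
    proof (rule rational_eq_Bminus_genericI[OF pn])
      fix x assume x: "x \<in> Bminus n" "x $$ (Suc p, p) \<noteq> 0"
      show "E {s..t} (crystal_e ?X i c x) = (if i = s then inverse c else 1) * E {s..t} x"
        using coord_uu_e_B[OF x(1) pn c x(2) st ne]
        unfolding e
        by (simp add: p E[OF st x(1)] E[OF st e_B_in_Bminus[OF x(1) pn c x(2)]])
    qed
    show "rational_eq ?X (\<lambda>x. Es {s..t} (crystal_e ?X i c x))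
        (\<lambda>x. (if i = t then inverse c else 1) * Es {s..t} x)"
    proof (rule rational_eq_Bminus_genericI[OF pn])
      fix x assume x: "x \<in> Bminus n" "x $$ (Suc p, p) \<noteq> 0"
      show "Es {s..t} (crystal_e ?X i c x) = (if i = t then inverse c else 1) * Es {s..t} x"
        using det_minor_M_e_B[OF x(1) pn c x(2) st ne]
        unfolding e
        by (simp add: p Es[OF st x(1)] Es[OF st e_B_in_Bminus[OF x(1) pn c x(2)]])
    qed
  qed
  have alternating: "rational_eq ?X (Es J)
      (\<lambda>x. \<Sum>P \<in> interval_partitions n J. (- 1) ^ (card J - card P) * (\<Prod>I \<in> P. E I x))"
    if Jn: "J \<in> intervals n" for J
  proof (rule rational_eq_BminusI)
    fix x assume x: "x \<in> Bminus n"
    obtain s t where J: "J = {s..t}" and st: "1 \<le> s" "s \<le> t" "t \<le> n"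
      using Jn by (auto simp: intervals_def)
    have "signed_partition_sum n (\<lambda>I. E I x) {s..t} = det (minor_M n x s t)"
      using E x by (intro signed_partition_sum_coord_uu[OF x st]) auto
    then show "Es J x =
        (\<Sum>P \<in> interval_partitions n J. (- 1) ^ (card J - card P) * (\<Prod>I \<in> P. E I x))"
      by (simp add: J Es[OF st x] signed_partition_sum_def)
  qed
  have crystal:
    "(i = s \<longrightarrow>
        rational_eq ?X (\<lambda>x. E {s..t} (crystal_e ?X i c x)) (\<lambda>x. inverse c * E {s..t} x)) \<and>
     (i + 1 \<noteq> s \<and> i \<noteq> s \<and> i \<noteq> t + 1 \<longrightarrow>
        rational_eq ?X (\<lambda>x. E {s..t} (crystal_e ?X i c x)) (\<lambda>x. E {s..t} x)) \<and>
     (i = t \<longrightarrow>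
        rational_eq ?X (\<lambda>x. Es {s..t} (crystal_e ?X i c x)) (\<lambda>x. inverse c * Es {s..t} x)) \<and>
     (i + 1 \<noteq> s \<and> i \<noteq> t \<and> i \<noteq> t + 1 \<longrightarrow>
        rational_eq ?X (\<lambda>x. Es {s..t} (crystal_e ?X i c x)) (\<lambda>x. Es {s..t} x))"
    if "1 \<le> s \<and> s \<le> t \<and> t \<le> n \<and> i \<in> {1..n} \<and> c \<noteq> 0" for s t i c
    using invariance[of s t i c] that by auto
  show ?thesis
    unfolding epsilon_system_def using regular eps crystal alternating by blast
qed

end
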